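(* Suppose that $$w_1<v_1<\dots<w_n<v_n<v_{n+1}<w_{n+1}<\dots<v_{2n}<w_{2n},$$ where the $v_k$ ($k=1,\dots,2n$) are the outcomes of Experiment A and the $w_k$ ($k=1,\dots,2n$) are the outcomes of Experiment B, and that the outcomes of the two experiments are interwoven. Suppose further that $P(v_k)=a_k=a_{2n+1-k}$ and $P(w_k)=b_k=b_{2n+1-k}$ for $k=1,\dots,2n$. Then Experiment A strictly predicts Experiment B.
   Context: The outcomes are real numbers, and in the displayed chain the $v$'s and $w$'s alternate except for the adjacent pair $v_n<v_{n+1}$ in the middle. The outcomes of A and B are interwoven if some of the outcomes of Experiment A are between outcomes of Experiment B, and vice versa. $P(v_k)$ is the probability of outcome $v_k$ in Experiment A and $P(w_k)$ the probability of outcome $w_k$ in Experiment B. Let $X$ be the result of a single trial of Experiment A and $Y$ the result of a single trial of Experiment B, with $X$ and $Y$ independent. A pointer is a real number $p$. Alice observes $X$ but not $Y$; she guesses "$X>Y$" if $p<X$ and guesses "$Y>X$" if $p>X$ (no guess is specified when $p=X$). $P(SG)$ denotes the probability that, with pointer $p$, her guess is successful. Experiment A strictly predicts Experiment B if every choice of pointer results in $P(SG)\ge\tfrac12$ and for some choice of pointer $P(SG)>\tfrac12$. *)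

theory Defs
  imports "HOL-Probability.Probability"
begin

text \<open>
  An experiment with real outcomes is a \<^typ>\<open>real pmf\<close>; its outcomes are the values of
  positive probability, i.e. its \<^const>\<open>set_pmf\<close>.
\<close>

definition interwoven :: "real pmf \<Rightarrow> real pmf \<Rightarrow> bool" where
  "interwoven A B \<longleftrightarrow>
     (\<exists>x\<in>set_pmf A. \<exists>y\<in>set_pmf B. \<exists>y'\<in>set_pmf B. y < x \<and> x < y') \<and>
     (\<exists>y\<in>set_pmf B. \<exists>x\<in>set_pmf A. \<exists>x'\<in>set_pmf A. x < y \<and> y < x')"

datatype guess = X_greater | Y_greater

fun correct_guess :: "guess \<Rightarrow> real \<Rightarrow> real \<Rightarrow> bool" where
  "correct_guess X_greater x y \<longleftrightarrow> x > y"
| "correct_guess Y_greater x y \<longleftrightarrow> y > x"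

text \<open>
  A guessing rule maps the observed value of X to a guess. A pointer p prescribes the guess
  only for observations different from p; the guess at p itself is deliberately left open.
\<close>

definition follows_pointer :: "real \<Rightarrow> (real \<Rightarrow> guess) \<Rightarrow> bool" where
  "follows_pointer p g \<longleftrightarrow>
     (\<forall>x. (p < x \<longrightarrow> g x = X_greater) \<and> (p > x \<longrightarrow> g x = Y_greater))"

definition prob_SG :: "real pmf \<Rightarrow> real pmf \<Rightarrow> (real \<Rightarrow> guess) \<Rightarrow> real" where
  "prob_SG A B g = measure_pmf.prob (pair_pmf A B) {(x, y). correct_guess (g x) x y}"

text \<open>
  If p is not an outcome of A, the success probability depends on the pointer alone, and the
  quantification over rules below is immaterial.
\<close>

lemma prob_SG_pointer:
  assumes "follows_pointer p g" "p \<notin> set_pmf A"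
  shows "prob_SG A B g =
    measure_pmf.prob (pair_pmf A B) {(x, y). p < x \<and> x > y \<or> p > x \<and> y > x}"
proof -
  have "AE z in measure_pmf (pair_pmf A B).
      (z \<in> {(x, y). correct_guess (g x) x y}) =
      (z \<in> {(x, y). p < x \<and> x > y \<or> p > x \<and> y > x})"
  proof (rule AE_pmfI, clarify)
    fix x y assume "(x, y) \<in> set_pmf (pair_pmf A B)"
    then have "x \<noteq> p" using assms(2) by auto
    then consider "p < x" | "p > x" by linarith
    then show "((x, y) \<in> {(x, y). correct_guess (g x) x y}) =
      ((x, y) \<in> {(x, y). p < x \<and> x > y \<or> p > x \<and> y > x})"
      using assms(1) by cases (auto simp: follows_pointer_def)
  qed
  then show ?thesis
    unfolding prob_SG_def by (intro measure_pmf.finite_measure_eq_AE) auto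
qed

text \<open>
  Where the pointer is itself an outcome of A, both inequalities are required for each way of
  completing the guess at p. Counting a tie as an unsuccessful guess instead would make the
  first condition fail in general.
\<close>

definition strictly_predicts :: "real pmf \<Rightarrow> real pmf \<Rightarrow> bool" where
  "strictly_predicts A B \<longleftrightarrow>
     (\<forall>p g. follows_pointer p g \<longrightarrow> prob_SG A B g \<ge> 1/2) \<and>
     (\<exists>p. \<forall>g. follows_pointer p g \<longrightarrow> prob_SG A B g > 1/2)"

end

theory Submission
  imports Defs
begin

text \<open>
  Let \<open>k \<le> n\<close>. By the symmetry of B, the mirror outcomes \<open>v k\<close> and \<open>v (2n+1-k)\<close> see B with left
  and right tails exchanged, and at least as much mass of B lies above \<open>v k\<close> as below it, strictly
  more for \<open>k < n\<close>. Whatever the pointer, it never guesses towards the lighter tail at both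
  points, so the success probabilities at these equally likely outcomes add up to at least 1. A
  pointer between \<open>v n\<close> and \<open>v (n+1)\<close> guesses towards the heavier tail throughout; being interwoven
  forces \<open>n \<ge> 2\<close>, and so the gain is strict at \<open>v 1\<close>.
\<close>

lemma strict_mono_on_atLeastAtMost_Suc:
  fixes f :: "nat \<Rightarrow> 'a::order"
  assumes "\<And>k. \<lbrakk>l \<le> k; k < m\<rbrakk> \<Longrightarrow> f k < f (Suc k)"
  shows "strict_mono_on {l..m} f"
proof (rule strict_mono_onI)
  fix i j :: nat
  assume "i \<in> {l..m}" "j \<in> {l..m}" "i < j"
  from \<open>i < j\<close> have "\<lbrakk>l \<le> i; j \<le> m\<rbrakk> \<Longrightarrow> f i < f j"
    by (induction i j rule: less_Suc_induct) (force intro: assms less_trans)+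
  then show "f i < f j" using \<open>i \<in> {l..m}\<close> \<open>j \<in> {l..m}\<close> by simp
qed

lemma sum_reflect_atLeastAtMost:
  fixes f :: "nat \<Rightarrow> 'a::comm_monoid_add"
  assumes "k \<le> m"
  shows "(\<Sum>j\<in>{1..k}. f (m + 1 - j)) = sum f {m+1-k..m}"
  by (rule sum.reindex_bij_witness[of _ "\<lambda>j. m + 1 - j" "\<lambda>j. m + 1 - j"]) (use assms in auto)

text \<open>Grouping each index with its mirror image lets a weight symmetric under reflection be
  factored out of each pair.\<close>

lemma sum_fold_middle:
  fixes f :: "nat \<Rightarrow> 'a::comm_monoid_add"
  shows "sum f {1..2*n} = (\<Sum>k\<in>{1..n}. f k + f (2*n + 1 - k))"
proof -
  have "sum f {1..2*n} = sum f {1..n} + sum f {n+1..2*n}"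
    by (subst sum.union_disjoint[symmetric]) (auto intro: sum.cong)
  also have "sum f {n+1..2*n} = (\<Sum>k\<in>{1..n}. f (2*n + 1 - k))"
    using sum_reflect_atLeastAtMost[of n "2*n" f] by simp
  finally show ?thesis by (simp add: sum.distrib)
qed

lemma prob_pmf_finite:
  assumes "finite (set_pmf B)"
  shows "measure_pmf.prob B {y. P y} = (\<Sum>y\<in>set_pmf B. if P y then pmf B y else 0)"
proof -
  have "measure_pmf.prob B {y. P y} = measure_pmf.prob B ({y. P y} \<inter> set_pmf B)"
    by (simp add: measure_Int_set_pmf)
  also have "\<dots> = sum (pmf B) ({y. P y} \<inter> set_pmf B)"
    using assms by (intro measure_measure_pmf_finite) simp
  also have "\<dots> = (\<Sum>y\<in>set_pmf B. if P y then pmf B y else 0)"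
    using assms by (simp add: sum.inter_restrict Int_commute)
  finally show ?thesis .
qed

text \<open>By independence, conditioning on the first component leaves the second one distributed
  as \<open>B\<close>.\<close>

lemma prob_pair_pmf_finite:
  assumes "finite (set_pmf A)" "finite (set_pmf B)"
  shows "measure_pmf.prob (pair_pmf A B) {(x, y). P x y} =
    (\<Sum>x\<in>set_pmf A. pmf A x * measure_pmf.prob B {y. P x y})"
proof -
  have "measure_pmf.prob (pair_pmf A B) {z. case z of (x, y) \<Rightarrow> P x y} =
      (\<Sum>(x, y)\<in>set_pmf A \<times> set_pmf B. if P x y then pmf A x * pmf B y else 0)"
    using assms by (subst prob_pmf_finite) (auto simp: pmf_pair intro!: sum.cong)
  also have "\<dots> = (\<Sum>x\<in>set_pmf A. pmf A x * measure_pmf.prob B {y. P x y})"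
    using assms(2)
    by (auto simp: prob_pmf_finite sum.cartesian_product[symmetric] sum_distrib_left
        intro!: sum.cong)
  finally show ?thesis .
qed

theorem theorem4:
  fixes A B :: "real pmf" and n :: nat and v w a b :: "nat \<Rightarrow> real"
  assumes "n \<ge> 1"
    and outcomes_A: "set_pmf A = v ` {1..2*n}"
    and outcomes_B: "set_pmf B = w ` {1..2*n}"
    and "\<forall>k\<in>{1..n}. w k < v k"
    and "\<forall>k\<in>{1..<n}. v k < w (k + 1)"
    and "v n < v (n + 1)"
    and "\<forall>k\<in>{n+1..2*n}. v k < w k"
    and "\<forall>k\<in>{n+1..<2*n}. w k < v (k + 1)"
    and "interwoven A B"
    and "\<forall>k\<in>{1..2*n}. pmf A (v k) = a k \<and> a k = a (2*n + 1 - k)"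
    and "\<forall>k\<in>{1..2*n}. pmf B (w k) = b k \<and> b k = b (2*n + 1 - k)"
  shows "strictly_predicts A B"
proof -

  \<comment> \<open>Order of the outcomes\<close>
  have wv: "w k < v k" if "1 \<le> k" "k \<le> n" for k using assms(4) that by simp
  have vw1: "v k < w (Suc k)" if "1 \<le> k" "k < n" for k using assms(5) that by simp
  have vw: "v k < w k" if "n < k" "k \<le> 2*n" for k using assms(7) that by simp
  have wv1: "w k < v (Suc k)" if "n < k" "k < 2*n" for k using assms(8) that by simp
  have vmid: "v n < v (Suc n)" using assms(6) by simp
  have fin: "finite (set_pmf A)" "finite (set_pmf B)" by (simp_all add: outcomes_A outcomes_B)
  have v_step: "v k < v (Suc k)" if "1 \<le> k" "k < 2*n" for k
  proof -
    \<comment> \<open>Inside either half of the chain a \<open>w\<close> separates consecutive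
      \<open>v\<close>s; only at \<open>k = n\<close> are two of them adjacent.\<close>
    consider "k < n" | "k = n" | "n < k" by linarith
    then show ?thesis
    proof cases
      case 1 then show ?thesis using vw1[of k] wv[of "Suc k"] that by simp
    next
      case 2 then show ?thesis using vmid by simp
    next
      case 3 then show ?thesis using vw[of k] wv1[of k] that by simp
    qed
  qed
  have w_step: "w k < w (Suc k)" if "1 \<le> k" "k < 2*n" for k
  proof -
    consider "k < n" | "k = n" | "n < k" by linarith
    then show ?thesis
    proof cases
      case 1 then show ?thesis using wv[of k] vw1[of k] that by simp
    next
      case 2 then show ?thesis using wv[of n] vmid vw[of "Suc n"] that by simp
    next
      case 3 then show ?thesis using wv1[of k] vw[of "Suc k"] that by simp
    qed
  qed
  note mono_v = strict_mono_on_atLeastAtMost_Suc[of 1 "2*n" v, OF v_step]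
  note mono_w = strict_mono_on_atLeastAtMost_Suc[of 1 "2*n" w, OF w_step]
  have v_less: "v i < v j" if "1 \<le> i" "i < j" "j \<le> 2*n" for i j
    using strict_mono_onD[OF mono_v] that by simp
  have w_le: "w i \<le> w j" if "1 \<le> i" "i \<le> j" "j \<le> 2*n" for i j
    using strict_mono_onD[OF mono_w, of i j] that by (cases "i = j") auto
  have inj_v: "inj_on v {1..2*n}" and inj_w: "inj_on w {1..2*n}"
    using mono_v mono_w by (simp_all add: strict_mono_on_imp_inj_on)

  \<comment> \<open>Weights and their totals\<close>
  have a_eq: "pmf A (v k) = a k" "a (2*n + 1 - k) = a k" if "k \<in> {1..2*n}" for k
    using assms(10) that by auto
  have b_eq: "pmf B (w k) = b k" "b (2*n + 1 - k) = b k" if "k \<in> {1..2*n}" for k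
    using assms(11) that by auto
  have a_pos: "a k > 0" if "k \<in> {1..2*n}" for k
    using that a_eq(1)[OF that] outcomes_A by (metis imageI pmf_positive)
  have b_pos: "b k > 0" if "k \<in> {1..2*n}" for k
    using that b_eq(1)[OF that] outcomes_B by (metis imageI pmf_positive)
  have sum_a: "sum a {1..2*n} = 1"
  proof -
    have "sum a {1..2*n} = sum (pmf A) (set_pmf A)"
      unfolding outcomes_A by (simp add: sum.reindex[OF inj_v] a_eq del: One_nat_def)
    then show ?thesis using sum_pmf_eq_1[OF fin(1)] by simp
  qed
  have sum_b: "sum b {1..2*n} = 1"
  proof -
    have "sum b {1..2*n} = sum (pmf B) (set_pmf B)"
      unfolding outcomes_B by (simp add: sum.reindex[OF inj_w] b_eq del: One_nat_def)
    then show ?thesis using sum_pmf_eq_1[OF fin(2)] by simp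
  qed
  have half_a: "sum a {1..n} = 1/2"
  proof -
    have "1 = (\<Sum>k\<in>{1..n}. a k + a (2*n + 1 - k))"
      using sum_a sum_fold_middle[of a n] by simp
    also have "\<dots> = (\<Sum>k\<in>{1..n}. 2 * a k)"
      by (intro sum.cong) (use a_eq(2) in auto)
    finally show ?thesis by (simp add: sum_distrib_left[symmetric])
  qed
  \<comment> \<open>Reduces every tail probability of \<open>B\<close> to finding the indices of the
    outcomes in that tail.\<close>
  have prob_B: "measure_pmf.prob B {y. P y} = sum b J"
    if "\<And>j. j \<in> {1..2*n} \<Longrightarrow> P (w j) \<longleftrightarrow> j \<in> J" "J \<subseteq> {1..2*n}" for P J
  proof -
    have "measure_pmf.prob B {y. P y} = (\<Sum>j\<in>{1..2*n}. if P (w j) then pmf B (w j) else 0)"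
      unfolding prob_pmf_finite[OF fin(2)] outcomes_B by (simp add: sum.reindex[OF inj_w] del: One_nat_def)
    also have "\<dots> = (\<Sum>j\<in>{1..2*n}. if j \<in> J then b j else 0)"
      by (intro sum.cong) (use that(1) b_eq(1) in auto)
    also have "\<dots> = sum b ({1..2*n} \<inter> J)" by (simp add: sum.inter_restrict)
    finally show ?thesis using that(2) by (simp add: Int_absorb1)
  qed

  \<comment> \<open>Partial sums of the weights of B and their symmetry\<close>
  define L where "L k = sum b {1..k}" for k
  define H where "H k = sum b {k+1..2*n}" for k
  have L_reflect: "L k = sum b {2*n+1-k..2*n}" if "k \<le> 2*n" for k
  proof -
    have "L k = (\<Sum>j\<in>{1..k}. b (2*n + 1 - j))"
      unfolding L_def by (intro sum.cong) (use b_eq(2) that in auto)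
    then show ?thesis using sum_reflect_atLeastAtMost[OF that, of b] by simp
  qed
  have L_plus_H: "L k + H k = 1" if "k \<le> 2*n" for k
  proof -
    have "L k + H k = sum b {1..2*n}" unfolding L_def H_def
      by (subst sum.union_disjoint[symmetric]) (use that in \<open>auto intro: sum.cong\<close>)
    then show ?thesis using sum_b by simp
  qed
  have L_le_H: "L k \<le> H k" if "k \<le> n" for k
  proof -
    have "L k = sum b {2*n+1-k..2*n}" using L_reflect that by simp
    \<comment> \<open>Since \<open>k \<le> n\<close>, the top \<open>k\<close> indices start at
      \<open>2*n+1-k \<ge> k+1\<close>, so they all occur in \<open>H k\<close>.\<close>
    also have "\<dots> \<le> H k" unfolding H_def
      by (rule sum_mono2) (use that b_pos in \<open>auto intro: less_imp_le\<close>)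
    finally show ?thesis .
  qed
  have L1_less_H1: "L 1 < H 1" if "n \<ge> 2"
  proof -
    have "L 1 = sum b {2*n}" using L_reflect[of 1] that by simp
    \<comment> \<open>The witness 2 is an index of positive weight counted in \<open>H 1\<close>,
      and it differs from \<open>2*n\<close> because \<open>n \<ge> 2\<close>.\<close>
    also have "\<dots> < H 1" unfolding H_def
      by (rule sum_strict_mono2[of _ _ 2]) (use that b_pos in \<open>auto intro: less_imp_le\<close>)
    finally show ?thesis .
  qed

  \<comment> \<open>Tails of B seen from the outcomes of A\<close>
  have below_low: "measure_pmf.prob B {y. y < v k} = L k"
    and above_low: "measure_pmf.prob B {y. v k < y} = H k" if "k \<in> {1..n}" for k
  proof -
    have *: "w j < v k" if "1 \<le> j" "j \<le> k" for j
      using wv[of k] w_le[of j k] that \<open>k \<in> {1..n}\<close> by simp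
    have **: "v k < w j" if "k < j" "j \<le> 2*n" for j
    proof -
      \<comment> \<open>At \<open>k = n\<close> the next outcome in the chain is
        \<open>v (n+1)\<close>, not a \<open>w\<close>, so the bound passes through it to
        \<open>w (n+1)\<close>.\<close>
      have "v k < w (Suc k)"
        using vw1[of k] v_step[of k] vw[of "Suc k"] \<open>k \<in> {1..n}\<close> by (cases "k < n") auto
      then show ?thesis using w_le[of "Suc k" j] that by simp
    qed
    have iff: "w j < v k \<longleftrightarrow> j \<le> k" "v k < w j \<longleftrightarrow> k < j" if "j \<in> {1..2*n}" for j
      using *[of j] **[of j] that by (cases "j \<le> k"; auto)+
    show "measure_pmf.prob B {y. y < v k} = L k" unfolding L_def
      by (rule prob_B) (use that iff in auto)
    show "measure_pmf.prob B {y. v k < y} = H k" unfolding H_def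
      by (rule prob_B) (use that iff in auto)
  qed
  have below_high: "measure_pmf.prob B {y. y < v (2*n + 1 - k)} = H k"
    and above_high: "measure_pmf.prob B {y. v (2*n + 1 - k) < y} = L k" if "k \<in> {1..n}" for k
  proof -
    let ?m = "2*n + 1 - k"
    have m: "n < ?m" "?m \<le> 2*n" using that by auto
    have *: "v ?m < w j" if "?m \<le> j" "j \<le> 2*n" for j
      using vw[of ?m] w_le[of ?m j] that m by simp
    have **: "w j < v ?m" if "1 \<le> j" "j < ?m" for j
    proof -
      have eq: "Suc (2*n - k) = ?m" using \<open>k \<in> {1..n}\<close> by auto
      \<comment> \<open>For \<open>k = n\<close> this is the middle of the chain again:
        \<open>w n < v n < v (n+1)\<close>.\<close>
      have "w (2*n - k) < v ?m"
        using wv1[of "2*n-k"] v_step[of "2*n-k"] wv[of "2*n-k"] \<open>k \<in> {1..n}\<close>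
        unfolding eq by (cases "k = n") auto
      moreover have "j \<le> 2*n - k" using that by linarith
      ultimately show ?thesis using w_le[of j "2*n - k"] that by simp
    qed
    have iff: "w j < v ?m \<longleftrightarrow> j < ?m" "v ?m < w j \<longleftrightarrow> ?m \<le> j" if "j \<in> {1..2*n}" for j
      using *[of j] **[of j] that by (cases "j < ?m"; simp)+
    have "measure_pmf.prob B {y. y < v ?m} = sum b {1..2*n-k}"
      by (rule prob_B) (use that iff in auto)
    \<comment> \<open>Reflection carries the lowest \<open>2*n-k\<close> indices to
      \<open>k+1, ..., 2*n\<close>.\<close>
    also have "\<dots> = H k" using L_reflect[of "2*n-k"] that by (simp add: L_def H_def)
    finally show "measure_pmf.prob B {y. y < v ?m} = H k" .
    have "measure_pmf.prob B {y. v ?m < y} = sum b {?m..2*n}"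
      by (rule prob_B) (use that iff in auto)
    then show "measure_pmf.prob B {y. v ?m < y} = L k" using L_reflect[of k] that by simp
  qed

  \<comment> \<open>Success probability given the observed outcome\<close>
  define S where "S g x = measure_pmf.prob B {y. correct_guess (g x) x y}" for g x
  have guesses: "{y. correct_guess (g x) x y} =
      (case g x of X_greater \<Rightarrow> {y. y < x} | Y_greater \<Rightarrow> {y. x < y})" for g x
    by (auto split: guess.split)
  have S_low: "S g (v k) = (case g (v k) of X_greater \<Rightarrow> L k | Y_greater \<Rightarrow> H k)"
    and S_high: "S g (v (2*n+1-k)) = (case g (v (2*n+1-k)) of X_greater \<Rightarrow> H k | Y_greater \<Rightarrow> L k)"
    if "k \<in> {1..n}" for g k
    unfolding S_def guesses using below_low above_low below_high above_high that
    by (simp_all split: guess.split)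
  have prob_SG_eq: "prob_SG A B g = (\<Sum>k\<in>{1..n}. a k * (S g (v k) + S g (v (2*n + 1 - k))))" for g
  proof -
    have "prob_SG A B g = (\<Sum>k\<in>{1..2*n}. a k * S g (v k))"
      unfolding prob_SG_def prob_pair_pmf_finite[OF fin] outcomes_A
      by (simp add: sum.reindex[OF inj_v] a_eq S_def del: One_nat_def)
    also have "\<dots> = (\<Sum>k\<in>{1..n}. a k * (S g (v k) + S g (v (2*n + 1 - k))))"
      unfolding sum_fold_middle by (intro sum.cong) (use a_eq(2) in \<open>auto simp: distrib_left\<close>)
    finally show ?thesis .
  qed
  have pair_ge: "S g (v k) + S g (v (2*n + 1 - k)) \<ge> 1"
    if "follows_pointer p g" "k \<in> {1..n}" for p g k
  proof -
    have "v k < v (2*n + 1 - k)" using v_less that(2) by auto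
    \<comment> \<open>Guessing \<open>X_greater\<close> at \<open>v k\<close> means
      \<open>p \<le> v k\<close>, even if the guess at \<open>p\<close> itself is free, so
      \<open>p\<close> lies strictly below the mirror outcome. This excludes the one bad
      combination, of value \<open>2 * L k\<close>; the others give \<open>L k + H k\<close> or
      \<open>2 * H k\<close>.\<close>
    then have "g (v (2*n + 1 - k)) = X_greater" if "g (v k) = X_greater"
      using \<open>follows_pointer p g\<close> that unfolding follows_pointer_def
      by (metis guess.distinct(1) linorder_less_linear order.strict_trans)
    then show ?thesis
      using L_plus_H[of k] L_le_H[of k] that(2) S_low[of k g] S_high[of k g]
      by (auto split: guess.splits)
  qed

  have n2: "n \<ge> 2"
  proof (rule ccontr)
    assume "\<not> n \<ge> 2"
    \<comment> \<open>For \<open>n = 1\<close> both outcomes of B lie outside the interval spanned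
      by those of A, so none is between two outcomes of A.\<close>
    then have "n = 1" using \<open>n \<ge> 1\<close> by simp
    moreover have "{1..2} = {1, 2::nat}" by auto
    ultimately have "set_pmf A = {v 1, v 2}" "set_pmf B = {w 1, w 2}"
      using outcomes_A outcomes_B by auto
    moreover have "w 1 < v 1" "v 1 < v 2" "v 2 < w 2"
      using wv[of 1] vmid vw[of 2] \<open>n = 1\<close> by (simp_all add: numeral_2_eq_2)
    ultimately show False using \<open>interwoven A B\<close> unfolding interwoven_def by auto
  qed

  \<comment> \<open>The two conditions of strict prediction\<close>
  have "prob_SG A B g \<ge> 1/2" if "follows_pointer p g" for p g
  proof -
    \<comment> \<open>The bound 1/2 is the value obtained if every mirror pair contributes exactly
      1.\<close>
    have "1/2 = (\<Sum>k\<in>{1..n}. a k * 1)" using half_a by simp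
    also have "\<dots> \<le> prob_SG A B g" unfolding prob_SG_eq
      by (intro sum_mono mult_left_mono) (use pair_ge[OF that] a_pos in \<open>auto intro: less_imp_le\<close>)
    finally show ?thesis .
  qed
  moreover have "prob_SG A B g > 1/2" if g: "follows_pointer ((v n + v (n + 1)) / 2) g" for g
  proof -
    let ?p = "(v n + v (n + 1)) / 2"
    have "v 1 < ?p" "?p < v (2*n)"
      using v_less[of 1 n] v_less[of "n+1" "2*n"] vmid n2 by auto
    then have "g (v 1) = Y_greater" "g (v (2*n)) = X_greater"
      using g by (auto simp: follows_pointer_def)
    \<comment> \<open>Both guesses point to the heavier tail, so the sum is \<open>2 * H 1\<close>,
      which exceeds \<open>L 1 + H 1 = 1\<close>.\<close>
    then have "S g (v 1) + S g (v (2*n + 1 - 1)) > 1"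
      using S_low[of 1 g] S_high[of 1 g] L1_less_H1 L_plus_H[of 1] n2 by simp
    then have strict: "a 1 * 1 < a 1 * (S g (v 1) + S g (v (2*n + 1 - 1)))"
      using a_pos[of 1] n2 by (intro mult_strict_left_mono) auto
    have "1/2 = (\<Sum>k\<in>{1..n}. a k * 1)" using half_a by simp
    also have "\<dots> < prob_SG A B g" unfolding prob_SG_eq
    proof (rule sum_strict_mono_ex1)
      show "\<forall>k\<in>{1..n}. a k * 1 \<le> a k * (S g (v k) + S g (v (2*n + 1 - k)))"
        using pair_ge[OF g] a_pos by (auto intro!: mult_left_mono less_imp_le)
      show "\<exists>k\<in>{1..n}. a k * 1 < a k * (S g (v k) + S g (v (2*n + 1 - k)))"
        using strict n2 by (intro bexI[of _ 1]) auto
    qed simp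
    finally show ?thesis .
  qed
  ultimately show ?thesis unfolding strictly_predicts_def by blast
qed

end
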